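(* Consider a random walk in the quarter-plane. Let $\Gamma\subset[0,\infty)^2$ be a set of finite cardinality, and suppose that the invariant measure $m$ of the random walk is induced by $\Gamma$. Let $\Gamma_I=\{(\rho,\sigma)\in\Gamma : \rho>0,\ \sigma>0\}$ be the set of non-degenerate geometric terms of $\Gamma$. Then $\Gamma_I\subset C$, where $C=\{(\rho,\sigma)\in[0,1)^2 : Q(\rho,\sigma)=0\}$.
   Context: Random walk in the quarter-plane: a discrete-time Markov chain on $S=\mathbb{N}_0\times\mathbb{N}_0$ determined by non-negative parameters $p_{s,t}$, $h_s$, $v_t$ ($s,t\in\{-1,0,1\}$) with the following transitions. From $(i,j)$ with $i>0,j>0$: to $(i+s,j+t)$ with probability $p_{s,t}$. From $(i,0)$ with $i>0$: to $(i+s,0)$ with probability $h_s$ and to $(i+s,1)$ with probability $p_{s,1}$. From $(0,j)$ with $j>0$: to $(0,j+t)$ with probability $v_t$ and to $(1,j+t)$ with probability $p_{1,t}$. From $(0,0)$: to $(1,0)$ with probability $h_1$, to $(0,1)$ with probability $v_1$, to $(1,1)$ with probability $p_{1,1}$, and to $(0,0)$ with the remaining probability $1-h_1-v_1-p_{1,1}\ge 0$. (Transition probabilities out of each state sum to 1.) The chain is assumed irreducible, aperiodic and positive recurrent. Invariant measure: the (up to a multiplicative constant unique) positive measure $m$ on $S$ satisfying, for all $i>0$, $j>0$, $m(i,j)=\sum_{s=-1}^{1}\sum_{t=-1}^{1}m(i-s,j-t)p_{s,t}$, $m(i,0)=\sum_{s=-1}^{1}m(i-s,1)p_{s,-1}+\sum_{s=-1}^{1}m(i-s,0)h_s$,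 $m(0,j)=\sum_{t=-1}^{1}m(1,j-t)p_{-1,t}+\sum_{t=-1}^{1}m(0,j-t)v_t$ (the balance equation at the origin is implied by these). Induced measure: a (signed) measure $m$ on $S$ is induced by $\Gamma\subset[0,\infty)^2$ if $m(i,j)=\sum_{(\rho,\sigma)\in\Gamma}\alpha(\rho,\sigma)\rho^i\sigma^j$ for all $(i,j)\in S$, with $\alpha(\rho,\sigma)\in\mathbb{R}\setminus\{0\}$ for all $(\rho,\sigma)\in\Gamma$, and with the convention $0^0=1$. $Q(\rho,\sigma)=\rho\sigma\left(\sum_{s=-1}^{1}\sum_{t=-1}^{1}\rho^{-s}\sigma^{-t}p_{s,t}-1\right)$, regarded as a polynomial in $\rho,\sigma$. *)

theory Defs
  imports Complex_Main "HOL-Analysis.Infinite_Sum"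
begin

type_synonym 'a kernel = "'a \<Rightarrow> 'a \<Rightarrow> real"

primrec n_step :: "'a kernel \<Rightarrow> nat \<Rightarrow> 'a kernel" where
  "n_step K 0 x y = of_bool (x = y)"
| "n_step K (Suc n) x y = (\<Sum>\<^sub>\<infinity>z. K x z * n_step K n z y)"

text \<open>Probability that the chain started in \<open>x\<close> visits \<open>y\<close> for the first time after time 0
  at time \<open>n\<close>; for \<open>x = y\<close> this is the distribution of the return time.\<close>

fun first_passage :: "'a kernel \<Rightarrow> nat \<Rightarrow> 'a kernel" where
  "first_passage K 0 x y = 0"
| "first_passage K (Suc 0) x y = K x y"
| "first_passage K (Suc (Suc n)) x y = (\<Sum>\<^sub>\<infinity>z\<in>- {y}. K x z * first_passage K (Suc n) z y)"

definition irreducible_chain :: "'a kernel \<Rightarrow> bool" where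
  "irreducible_chain K \<longleftrightarrow> (\<forall>x y. \<exists>n. n_step K n x y > 0)"

definition aperiodic_chain :: "'a kernel \<Rightarrow> bool" where
  "aperiodic_chain K \<longleftrightarrow> (\<forall>x. Gcd {n. n > 0 \<and> n_step K n x x > 0} = 1)"

definition positive_recurrent_chain :: "'a kernel \<Rightarrow> bool" where
  "positive_recurrent_chain K \<longleftrightarrow>
     (\<forall>x. (\<lambda>n. first_passage K n x x) sums 1 \<and>
          summable (\<lambda>n. real n * first_passage K n x x))"

text \<open>Only the values of the parameters at indices in \<open>{-1..1}\<close> are relevant.\<close>

definition quarter_plane_walk ::
    "(int \<Rightarrow> int \<Rightarrow> real) \<Rightarrow> (int \<Rightarrow> real) \<Rightarrow> (int \<Rightarrow> real) \<Rightarrow> bool" where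
  "quarter_plane_walk p h v \<longleftrightarrow>
     (\<forall>s\<in>{-1..1}. \<forall>t\<in>{-1..1}. p s t \<ge> 0) \<and>
     (\<forall>s\<in>{-1..1}. h s \<ge> 0) \<and>
     (\<forall>t\<in>{-1..1}. v t \<ge> 0) \<and>
     (\<Sum>s\<in>{-1..1}. \<Sum>t\<in>{-1..1}. p s t) = 1 \<and>
     (\<Sum>s\<in>{-1..1}. h s) + (\<Sum>s\<in>{-1..1}. p s 1) = 1 \<and>
     (\<Sum>t\<in>{-1..1}. v t) + (\<Sum>t\<in>{-1..1}. p 1 t) = 1 \<and>
     1 - h 1 - v 1 - p 1 1 \<ge> 0"

definition qp_kernel ::
    "(int \<Rightarrow> int \<Rightarrow> real) \<Rightarrow> (int \<Rightarrow> real) \<Rightarrow> (int \<Rightarrow> real) \<Rightarrow> (nat \<times> nat) kernel" where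
  "qp_kernel p h v = (\<lambda>(i, j) (k, l).
     let s = int k - int i; t = int l - int j in
     if s \<notin> {-1..1} \<or> t \<notin> {-1..1} then 0
     else if i > 0 \<and> j > 0 then p s t
     else if i > 0 then (if t = 0 then h s else p s 1)
     else if j > 0 then (if s = 0 then v t else p 1 t)
     else if s = 1 \<and> t = 0 then h 1
     else if s = 0 \<and> t = 1 then v 1
     else if s = 1 \<and> t = 1 then p 1 1
     else 1 - h 1 - v 1 - p 1 1)"

text \<open>The balance equation at the origin follows from the other three for summable \<open>m\<close>, but
  not in general; it is part of the notion of an invariant measure, so it is listed explicitly.\<close>

definition invariant_measure ::
    "(int \<Rightarrow> int \<Rightarrow> real) \<Rightarrow> (int \<Rightarrow> real) \<Rightarrow> (int \<Rightarrow> real) \<Rightarrow> (nat \<Rightarrow> nat \<Rightarrow> real) \<Rightarrow> bool" where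
  "invariant_measure p h v m \<longleftrightarrow>
     (\<forall>i j. m i j \<ge> 0) \<and> (\<exists>i j. m i j \<noteq> 0) \<and>
     (\<forall>i>0. \<forall>j>0. m i j =
        (\<Sum>s\<in>{-1..1}. \<Sum>t\<in>{-1..1}. m (nat (int i - s)) (nat (int j - t)) * p s t)) \<and>
     (\<forall>i>0. m i 0 =
        (\<Sum>s\<in>{-1..1}. m (nat (int i - s)) 1 * p s (-1)) +
        (\<Sum>s\<in>{-1..1}. m (nat (int i - s)) 0 * h s)) \<and>
     (\<forall>j>0. m 0 j =
        (\<Sum>t\<in>{-1..1}. m 1 (nat (int j - t)) * p (-1) t) +
        (\<Sum>t\<in>{-1..1}. m 0 (nat (int j - t)) * v t)) \<and>
     m 0 0 = m 1 1 * p (-1) (-1) + m 1 0 * h (-1) + m 0 1 * v (-1)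
           + m 0 0 * (1 - h 1 - v 1 - p 1 1)"

definition induced_by :: "(nat \<Rightarrow> nat \<Rightarrow> real) \<Rightarrow> (real \<times> real) set \<Rightarrow> bool" where
  "induced_by m \<Gamma> \<longleftrightarrow>
     (\<exists>\<alpha>. (\<forall>x\<in>\<Gamma>. \<alpha> x \<noteq> 0) \<and>
          (\<forall>i j. ((\<lambda>(\<rho>, \<sigma>). \<alpha> (\<rho>, \<sigma>) * \<rho> ^ i * \<sigma> ^ j) has_sum m i j) \<Gamma>))"

text \<open>The factor \<open>\<rho> \<sigma>\<close> is multiplied out, so that this is the polynomial also where
  \<open>\<rho> = 0\<close> or \<open>\<sigma> = 0\<close>.\<close>

definition Q :: "(int \<Rightarrow> int \<Rightarrow> real) \<Rightarrow> real \<Rightarrow> real \<Rightarrow> real" where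
  "Q p \<rho> \<sigma> =
     (\<Sum>s\<in>{-1..1}. \<Sum>t\<in>{-1..1}. \<rho> ^ nat (1 - s) * \<sigma> ^ nat (1 - t) * p s t) - \<rho> * \<sigma>"

definition C :: "(int \<Rightarrow> int \<Rightarrow> real) \<Rightarrow> (real \<times> real) set" where
  "C p = {(\<rho>, \<sigma>). \<rho> \<in> {0..<1} \<and> \<sigma> \<in> {0..<1} \<and> Q p \<rho> \<sigma> = 0}"

definition nondegenerate :: "(real \<times> real) set \<Rightarrow> (real \<times> real) set" where
  "nondegenerate \<Gamma> = {(\<rho>, \<sigma>) \<in> \<Gamma>. \<rho> > 0 \<and> \<sigma> > 0}"

end

(* The finite linear combinations of exponentials \<rho>^i \<sigma>^j are acted on by the shifts in i and j with
   distinct joint eigenvalues, so a shift-invariant linear space that contains such a combination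
   contains each of its terms. The inner balance equations say that replacing \<alpha>(\<rho>,\<sigma>) by
   \<alpha>(\<rho>,\<sigma>) Q(\<rho>,\<sigma>) turns m into 0, so every Q(\<rho>,\<sigma>) vanishes. Positive recurrence makes m summable,
   so m tends to 0 along rows and columns; the same then holds for each term, so \<rho>, \<sigma> < 1. *)

theory Submission
  imports Defs
begin

section \<open>Separating the terms of a finite sum of exponentials\<close>

text \<open>A shift minus its eigenvalue at \<open>y\<close> kills the term of \<open>y\<close> and
  only rescales the others, so induction on \<Gamma> applies. The coefficients \<open>c\<close> may
  vanish, since the rescaling can kill further terms.\<close>

lemma sum_exponentials_component_mem:
  fixes V :: "(nat \<Rightarrow> nat \<Rightarrow> real) set" and \<Gamma> :: "(real \<times> real) set" and c :: "real \<times> real \<Rightarrow> real"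
  assumes diff: "\<And>f g. f \<in> V \<Longrightarrow> g \<in> V \<Longrightarrow> (\<lambda>i j. f i j - g i j) \<in> V"
    and scale: "\<And>f a. f \<in> V \<Longrightarrow> (\<lambda>i j. a * f i j) \<in> V"
    and shift1: "\<And>f. f \<in> V \<Longrightarrow> (\<lambda>i j. f (Suc i) j) \<in> V"
    and shift2: "\<And>f. f \<in> V \<Longrightarrow> (\<lambda>i j. f i (Suc j)) \<in> V"
    and "finite \<Gamma>"
    and "(\<lambda>i j. \<Sum>x\<in>\<Gamma>. c x * fst x ^ i * snd x ^ j) \<in> V"
    and "x \<in> \<Gamma>"
  shows "(\<lambda>i j. c x * fst x ^ i * snd x ^ j) \<in> V"
  using assms(5-7)
proof (induction \<Gamma> arbitrary: c x rule: finite_induct)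
  case (insert y \<Gamma>)
  let ?f = "\<lambda>i j. \<Sum>x\<in>insert y \<Gamma>. c x * fst x ^ i * snd x ^ j"
  have zero: "(\<lambda>i j. 0) \<in> V"
    using scale[OF insert.prems(1), of 0] by simp
  have cancel: "inverse d * (a * d * b * e) = a * b * e" if "d \<noteq> 0" for a b d e :: real
    using that by simp
  have old: "(\<lambda>i j. c z * fst z ^ i * snd z ^ j) \<in> V" if z: "z \<in> \<Gamma>" for z
  proof -
    have "z \<noteq> y" using z insert.hyps by auto
    then consider "fst z \<noteq> fst y" | "snd z \<noteq> snd y" by (auto simp: prod_eq_iff)
    then show ?thesis
    proof cases
      case 1
      \<comment> \<open>The term of \<open>x\<close> gets the factor \<open>fst x - fst y\<close>:
        zero at \<open>y\<close>, invertible at \<open>z\<close>.\<close>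
      have "(\<lambda>i j. ?f (Suc i) j - fst y * ?f i j) \<in> V"
        by (intro diff shift1[of ?f] scale insert.prems(1))
      also have "(\<lambda>i j. ?f (Suc i) j - fst y * ?f i j) =
          (\<lambda>i j. \<Sum>x\<in>\<Gamma>. (c x * (fst x - fst y)) * fst x ^ i * snd x ^ j)"
        using insert.hyps by (simp add: sum_distrib_left sum_subtractf algebra_simps)
      finally have "(\<lambda>i j. (c z * (fst z - fst y)) * fst z ^ i * snd z ^ j) \<in> V"
        using insert.IH[of "\<lambda>x. c x * (fst x - fst y)"] z by blast
      from scale[OF this, of "inverse (fst z - fst y)"] show ?thesis using 1 by (simp add: cancel)
    next
      case 2
      have "(\<lambda>i j. ?f i (Suc j) - snd y * ?f i j) \<in> V"
        by (intro diff shift2[of ?f] scale insert.prems(1))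
      also have "(\<lambda>i j. ?f i (Suc j) - snd y * ?f i j) =
          (\<lambda>i j. \<Sum>x\<in>\<Gamma>. (c x * (snd x - snd y)) * fst x ^ i * snd x ^ j)"
        using insert.hyps by (simp add: sum_distrib_left sum_subtractf algebra_simps)
      finally have "(\<lambda>i j. (c z * (snd z - snd y)) * fst z ^ i * snd z ^ j) \<in> V"
        using insert.IH[of "\<lambda>x. c x * (snd x - snd y)"] z by blast
      from scale[OF this, of "inverse (snd z - snd y)"] show ?thesis using 2 by (simp add: cancel)
    qed
  qed
  \<comment> \<open>The terms of \<Gamma>, already known to lie in \<open>V\<close>, are removed one
    by one until only that of \<open>y\<close> is left.\<close>
  have "(\<lambda>i j. ?f i j - (\<Sum>x\<in>A. c x * fst x ^ i * snd x ^ j)) \<in> V" if "A \<subseteq> \<Gamma>" for A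
    using finite_subset[OF that insert.hyps(1)] that
  proof (induction A rule: finite_induct)
    case empty
    then show ?case using insert.prems(1) by simp
  next
    case (insert z A)
    have "(\<lambda>i j. (?f i j - (\<Sum>x\<in>A. c x * fst x ^ i * snd x ^ j)) - c z * fst z ^ i * snd z ^ j) \<in> V"
      using insert by (intro diff[OF _ old]) auto
    then show ?case using insert.hyps by (simp add: algebra_simps)
  qed
  from this[OF order_refl] have "(\<lambda>i j. c y * fst y ^ i * snd y ^ j) \<in> V"
    using insert.hyps by simp
  then show ?case using old insert.prems(2) by (cases "x = y") simp_all
qed simp

section \<open>Hitting probabilities and summability of invariant measures\<close>

locale finitely_branching_chain =
  fixes K :: "'a kernel"
  assumes K_nonneg: "K x y \<ge> 0"
    and finite_support: "finite {y. K x y \<noteq> 0}"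
    and K_has_sum: "(K x has_sum 1) UNIV"
begin

lemma n_step_nonneg: "n_step K n x y \<ge> 0"
  by (induction n arbitrary: x) (auto intro!: infsum_nonneg mult_nonneg_nonneg K_nonneg)

lemma first_passage_nonneg: "first_passage K n x y \<ge> 0"
proof (induction n arbitrary: x)
  case (Suc n)
  then show ?case by (cases n) (auto intro!: infsum_nonneg mult_nonneg_nonneg K_nonneg)
qed simp

text \<open>\<open>Z\<close> may exceed the support of \<open>K x\<close>, so that several starting
  points can share one finite index set.\<close>

lemma first_passage_Suc_Suc:
  assumes "finite Z" "{z. K x z \<noteq> 0} \<subseteq> Z"
  shows "first_passage K (Suc (Suc n)) x y = (\<Sum>z\<in>Z - {y}. K x z * first_passage K (Suc n) z y)"
proof -
  have "first_passage K (Suc (Suc n)) x y = (\<Sum>\<^sub>\<infinity>z\<in>Z - {y}. K x z * first_passage K (Suc n) z y)"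
    unfolding first_passage.simps using assms by (intro infsum_cong_neutral) auto
  then show ?thesis using assms by simp
qed

text \<open>First-step analysis: the first step either hits \<open>y\<close> or leads to some other
  \<open>z\<close>, from where one time unit less remains.\<close>

lemma sum_first_passage_Suc:
  "(\<Sum>n\<le>Suc N. first_passage K n x y) =
     K x y + (\<Sum>z\<in>{z. K x z \<noteq> 0} - {y}. K x z * (\<Sum>n\<le>N. first_passage K n z y))"
proof (induction N)
  case (Suc N)
  have "(\<Sum>n\<le>Suc (Suc N). first_passage K n x y) =
      (\<Sum>n\<le>Suc N. first_passage K n x y) + first_passage K (Suc (Suc N)) x y"
    by (rule sum.atMost_Suc)
  then show ?case
    unfolding Suc.IH first_passage_Suc_Suc[OF finite_support order_refl]
    by (simp add: distrib_left sum.distrib)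
qed simp

lemma K_sum: "K x y + (\<Sum>z\<in>{z. K x z \<noteq> 0} - {y}. K x z) = 1"
proof -
  have "(K x has_sum 1) (insert y {z. K x z \<noteq> 0})"
    using K_has_sum by (rule has_sum_cong_neutral[THEN iffD1, rotated -1]) auto
  moreover have "insert y {z. K x z \<noteq> 0} = insert y ({z. K x z \<noteq> 0} - {y})" by auto
  ultimately show ?thesis
    using finite_support[of x] by (simp add: has_sum_finite_iff del: insert_Diff_single)
qed

lemma sum_first_passage_le_1: "(\<Sum>n\<le>N. first_passage K n x y) \<le> 1"
proof (induction N arbitrary: x)
  case (Suc N)
  have "(\<Sum>z\<in>{z. K x z \<noteq> 0} - {y}. K x z * (\<Sum>n\<le>N. first_passage K n z y))
      \<le> (\<Sum>z\<in>{z. K x z \<noteq> 0} - {y}. K x z * 1)"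
    by (intro sum_mono mult_left_mono Suc.IH K_nonneg)
  then show ?case using K_sum[of x y] unfolding sum_first_passage_Suc by simp
qed simp

text \<open>This is the probability of ever visiting \<open>y\<close> at a positive time, so
  \<open>hit y y\<close> is the return probability.\<close>

definition hit :: "'a \<Rightarrow> 'a \<Rightarrow> real" where
  "hit x y = (\<Sum>n. first_passage K n x y)"

lemma summable_first_passage: "summable (\<lambda>n. first_passage K n x y)"
  by (rule bounded_imp_summable[OF first_passage_nonneg sum_first_passage_le_1])

lemma sum_first_passage_tendsto: "(\<lambda>N. \<Sum>n\<le>N. first_passage K n x y) \<longlonglongrightarrow> hit x y"
  unfolding hit_def by (rule summable_LIMSEQ'[OF summable_first_passage])

lemma hit_le_1: "hit x y \<le> 1"
  by (rule LIMSEQ_le_const2[OF sum_first_passage_tendsto]) (use sum_first_passage_le_1 in blast)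

lemma hit_eq: "hit x y = K x y + (\<Sum>z\<in>{z. K x z \<noteq> 0} - {y}. K x z * hit z y)"
proof (rule LIMSEQ_unique)
  show "(\<lambda>N. \<Sum>n\<le>Suc N. first_passage K n x y) \<longlonglongrightarrow> hit x y"
    using sum_first_passage_tendsto by (rule LIMSEQ_Suc)
  show "(\<lambda>N. \<Sum>n\<le>Suc N. first_passage K n x y)
      \<longlonglongrightarrow> K x y + (\<Sum>z\<in>{z. K x z \<noteq> 0} - {y}. K x z * hit z y)"
    unfolding sum_first_passage_Suc by (intro tendsto_intros sum_first_passage_tendsto)
qed

text \<open>By \<open>hit_eq\<close>, \<open>hit x y\<close> is an average of numbers at most 1. If
  it equals 1, every number with positive weight is 1.\<close>

lemma hit_eq_1_step:
  assumes "hit y y = 1" "hit x y = 1" "K x z > 0"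
  shows "hit z y = 1"
proof (cases "z = y")
  case False
  have "(\<Sum>w\<in>{w. K x w \<noteq> 0} - {y}. K x w * (1 - hit w y)) = 0"
    using hit_eq[of x y] K_sum[of x y] assms(2) by (simp add: right_diff_distrib sum_subtractf)
  then have "\<forall>w\<in>{w. K x w \<noteq> 0} - {y}. K x w * (1 - hit w y) = 0"
    by (subst (asm) sum_nonneg_eq_0_iff) (auto simp: finite_support K_nonneg hit_le_1)
  then show ?thesis using False assms(3) by force
qed (use assms in simp)

text \<open>With \<open>x = y\<close>, recurrence of \<open>y\<close> and irreducibility, this shows
  that \<open>y\<close> is reached almost surely from every state.\<close>

lemma hit_eq_1_n_step:
  assumes "hit y y = 1" "hit x y = 1" "n_step K n x z > 0"
  shows "hit z y = 1"
  using assms(2,3)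
proof (induction n arbitrary: x)
  case 0
  then show ?case by (auto split: if_splits)
next
  case (Suc n)
  have "\<exists>w. K x w * n_step K n w z \<noteq> 0"
  proof (rule ccontr)
    assume "\<not> ?thesis"
    then have "n_step K (Suc n) x z = 0" unfolding n_step.simps by (intro infsum_0) simp
    then show False using Suc.prems by simp
  qed
  then obtain w where "K x w \<noteq> 0" "n_step K n w z \<noteq> 0" by auto
  then have "K x w > 0" "n_step K n w z > 0"
    using K_nonneg[of x w] n_step_nonneg[of n w z] by auto
  then show ?case using Suc hit_eq_1_step[OF assms(1)] by blast
qed

text \<open>Starting from the restriction of \<open>m\<close> to the complement of \<open>x\<close>, the mass hitting \<open>x\<close> first at time
  \<open>n\<close> is, by invariance, at most \<open>m x\<close> times the probability that a return to \<open>x\<close> takes longer than \<open>n\<close>.\<close>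

lemma sum_first_passage_invariant_le:
  assumes m_nonneg: "\<And>y. m y \<ge> 0"
    and inv: "\<And>y. ((\<lambda>z. m z * K z y) has_sum m y) UNIV"
    and "finite W" "x \<notin> W"
  shows "(\<Sum>w\<in>W. m w * first_passage K (Suc n) w x) \<le>
           m x * (1 - (\<Sum>k\<le>Suc n. first_passage K k x x))"
proof -
  have le: "(\<Sum>z\<in>Z. m z * K z y) \<le> m y" if "finite Z" for Z y
    using that by (intro finite_sum_le_has_sum[OF inv]) (auto simp: m_nonneg K_nonneg)
  show ?thesis
    using assms(3,4)
  proof (induction n arbitrary: W)
    case 0
    then show ?case using le[of "insert x W" x] by (simp add: algebra_simps)
  next
    case (Suc n)
    \<comment> \<open>All states reachable in one step from \<open>insert x W\<close>, a common
      index set for the first-step expansions.\<close>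
    define Z where "Z = (\<Union>w\<in>insert x W. {z. K w z \<noteq> 0})"
    have "finite Z" using Suc.prems finite_support by (auto simp: Z_def)
    \<comment> \<open>The additional summand at \<open>x\<close> is \<open>m x\<close> times the
      probability of a first return at time \<open>Suc (Suc n)\<close>. Moved to the right at the
      end, it turns the tail in the induction hypothesis into the next one.\<close>
    have "(\<Sum>w\<in>insert x W. m w * first_passage K (Suc (Suc n)) w x)
        = (\<Sum>w\<in>insert x W. m w * (\<Sum>z\<in>Z - {x}. K w z * first_passage K (Suc n) z x))"
      by (intro sum.cong refl arg_cong2[of _ _ _ _ "(*)"] first_passage_Suc_Suc \<open>finite Z\<close>)
         (auto simp: Z_def)
    also have "\<dots> = (\<Sum>z\<in>Z - {x}. (\<Sum>w\<in>insert x W. m w * K w z) * first_passage K (Suc n) z x)"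
      unfolding sum_distrib_left sum_distrib_right mult.assoc[symmetric] by (rule sum.swap)
    also have "\<dots> \<le> (\<Sum>z\<in>Z - {x}. m z * first_passage K (Suc n) z x)"
      using Suc.prems by (intro sum_mono mult_right_mono le first_passage_nonneg) auto
    also have "\<dots> \<le> m x * (1 - (\<Sum>k\<le>Suc n. first_passage K k x x))"
      using \<open>finite Z\<close> by (intro Suc.IH) auto
    finally show ?case using Suc.prems by (simp add: algebra_simps del: first_passage.simps)
  qed
qed

text \<open>Every state hits a fixed \<open>x\<close> almost surely, so the mass of a finite set
  avoiding \<open>x\<close> can be sorted by hitting time. The mass for each time is bounded by
  \<open>m x\<close> times a tail of the return time, and the tails add up to at most the mean
  return time.\<close>

lemma invariant_measure_summable:
  assumes irr: "irreducible_chain K" and rec: "positive_recurrent_chain K"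
    and m_nonneg: "\<And>y. m y \<ge> 0"
    and inv: "\<And>y. ((\<lambda>z. m z * K z y) has_sum m y) UNIV"
  shows "m summable_on UNIV"
proof -
  fix x :: 'a
  define f where "f = (\<lambda>n. first_passage K n x x)"
  \<comment> \<open>The mean return time to \<open>x\<close>, finite by positive recurrence.\<close>
  define B where "B = (\<Sum>n. real n * f n)"
  have f: "f sums 1" "summable (\<lambda>n. real n * f n)" and f_nonneg: "\<And>n. f n \<ge> 0"
    using rec by (auto simp: positive_recurrent_chain_def f_def first_passage_nonneg)
  have hit: "hit y x = 1" for y
  proof -
    have "hit x x = 1" using f(1) by (simp add: hit_def f_def sums_iff)
    moreover obtain n where "n_step K n x y > 0" using irr by (auto simp: irreducible_chain_def)
    ultimately show ?thesis using hit_eq_1_n_step by blast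
  qed
  have tails: "(\<Sum>n\<le>N. 1 - (\<Sum>k\<le>n. f k)) \<le> B" for N
  proof -
    \<comment> \<open>Truncated tail-sum formula for the mean. The last summand is bounded below by
      comparing \<open>real N + 1\<close> with \<open>k\<close> for all times
      \<open>k > N\<close>.\<close>
    have eq: "(\<Sum>n\<le>N. 1 - (\<Sum>k\<le>n. f k)) =
        (\<Sum>k\<le>N. real k * f k) + (real N + 1) * (1 - (\<Sum>k\<le>N. f k))"
      by (induction N) (auto simp: algebra_simps)
    have "(\<lambda>k. f (k + Suc N)) sums (1 - (\<Sum>k\<le>N. f k))"
      using sums_split_initial_segment[OF f(1), of "Suc N"] by (simp add: lessThan_Suc_atMost)
    then have s: "(\<lambda>k. (real N + 1) * f (k + Suc N)) sums ((real N + 1) * (1 - (\<Sum>k\<le>N. f k)))"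
      by (rule sums_mult)
    have t: "(\<lambda>k. real (k + Suc N) * f (k + Suc N)) sums (B - (\<Sum>k\<le>N. real k * f k))"
      using sums_split_initial_segment[OF summable_sums[OF f(2)], of "Suc N"]
      unfolding B_def lessThan_Suc_atMost .
    have "(real N + 1) * (1 - (\<Sum>k\<le>N. f k)) \<le> B - (\<Sum>k\<le>N. real k * f k)"
      by (rule sums_le[OF _ s t]) (auto intro!: mult_right_mono f_nonneg)
    with eq show ?thesis by simp
  qed
  have bound: "sum m W \<le> m x * B" if W: "finite W" "x \<notin> W" for W
  proof (rule LIMSEQ_le_const2)
    \<comment> \<open>Since \<open>hit w x = 1\<close>, no mass is lost in the limit.\<close>
    have "(\<lambda>N. \<Sum>w\<in>W. m w * (\<Sum>n\<le>N. first_passage K n w x)) \<longlonglongrightarrow> (\<Sum>w\<in>W. m w * 1)"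
      using sum_first_passage_tendsto[of _ x] unfolding hit by (intro tendsto_intros)
    then show "(\<lambda>N. \<Sum>w\<in>W. m w * (\<Sum>n\<le>N. first_passage K n w x)) \<longlonglongrightarrow> sum m W" by simp
    have "(\<Sum>w\<in>W. m w * (\<Sum>n\<le>N. first_passage K n w x)) \<le> m x * B" for N
    proof -
      have "(\<Sum>w\<in>W. m w * (\<Sum>n\<le>N. first_passage K n w x)) =
          (\<Sum>n\<le>N. \<Sum>w\<in>W. m w * first_passage K n w x)"
        unfolding sum_distrib_left by (rule sum.swap)
      also have "\<dots> \<le> (\<Sum>n\<le>N. m x * (1 - (\<Sum>k\<le>n. f k)))"
      proof (rule sum_mono)
        fix n
        show "(\<Sum>w\<in>W. m w * first_passage K n w x) \<le> m x * (1 - (\<Sum>k\<le>n. f k))"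
          \<comment> \<open>The lemma covers positive times; at time 0 the left side is 0.\<close>
          using sum_first_passage_invariant_le[OF m_nonneg inv W] m_nonneg[of x]
          by (cases n) (auto simp: f_def)
      qed
      also have "\<dots> \<le> m x * B"
        unfolding sum_distrib_left[symmetric] by (intro mult_left_mono tails m_nonneg)
      finally show ?thesis .
    qed
    then show "\<exists>N. \<forall>n\<ge>N. (\<Sum>w\<in>W. m w * (\<Sum>n\<le>n. first_passage K n w x)) \<le> m x * B" by blast
  qed
  have "sum m W \<le> m x + m x * B" if "finite W" for W
  proof -
    have "sum m W \<le> sum m (insert x (W - {x}))"
      using that by (intro sum_mono2) (auto simp: m_nonneg)
    also have "\<dots> \<le> m x + m x * B"
      using bound[of "W - {x}"] that by (simp del: insert_Diff_single)
    finally show ?thesis .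
  qed
  then show ?thesis
    by (intro nonneg_bdd_above_summable_on bdd_aboveI2[where M = "m x + m x * B"])
       (auto simp: m_nonneg)
qed

end

section \<open>The quarter-plane walk as a finitely branching chain\<close>

text \<open>The first two facts confine the targets of a step, the last two its sources. Truncated
  subtraction cuts the intervals off at the axes.\<close>

lemma qp_kernel_nonzero_imp:
  assumes "qp_kernel p h v (i, j) (k, l) \<noteq> 0"
  shows "k \<in> {i - 1..i + 1}" "l \<in> {j - 1..j + 1}" "i \<in> {k - 1..k + 1}" "j \<in> {l - 1..l + 1}"
  using assms by (auto simp: qp_kernel_def Let_def split: if_splits)

lemma neighbours_Suc: "{Suc a - 1..Suc a + 1} = {a, Suc a, Suc (Suc a)}"
  and neighbours_0: "{0 - 1..0 + 1} = {0, Suc 0}"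
  by auto

lemma sum_steps: "(\<Sum>s\<in>{-1..1}. f s) = f (-1) + f 0 + f (1 :: int)" for f :: "int \<Rightarrow> real"
proof -
  have "{-1..1 :: int} = {-1, 0, 1}" by auto
  then show ?thesis by simp
qed

lemma nat_steps:
  "nat (int (Suc a) - (-1)) = Suc (Suc a)" "nat (int (Suc a) - 0) = Suc a" "nat (int (Suc a) - 1) = a"
  by auto

lemma finitely_branching_chain_qp_kernel:
  assumes "quarter_plane_walk p h v"
  shows "finitely_branching_chain (qp_kernel p h v)"
proof
  fix x y :: "nat \<times> nat"
  obtain i j where x: "x = (i, j)" by force
  let ?N = "{i - 1..i + 1} \<times> {j - 1..j + 1}"
  show "qp_kernel p h v x y \<ge> 0"
    using assms by (auto simp: qp_kernel_def quarter_plane_walk_def Let_def split: prod.split)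
  have sub: "{y. qp_kernel p h v x y \<noteq> 0} \<subseteq> ?N"
    using qp_kernel_nonzero_imp(1,2) unfolding x by auto
  then show "finite {y. qp_kernel p h v x y \<noteq> 0}"
    by (rule finite_subset) simp
  \<comment> \<open>In the interior and on each axis the expanded sum is one of the normalisation
    conditions; at the origin the probability of staying makes it 1.\<close>
  have sum: "(\<Sum>y\<in>?N. qp_kernel p h v x y) = 1"
    using assms unfolding quarter_plane_walk_def sum_steps sum.cartesian_product' x
    by (cases i; cases j; hypsubst; simp only: neighbours_Suc neighbours_0) (simp_all add: qp_kernel_def)
  have "(qp_kernel p h v x has_sum 1) ?N"
    by (subst has_sum_finite_iff) (use sum in simp_all)
  then show "(qp_kernel p h v x has_sum 1) UNIV"
    by (rule has_sum_cong_neutral[THEN iffD1, rotated -1]) (use sub in auto)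
qed

text \<open>Only neighbours of \<open>y\<close> contribute, and the four positions of
  \<open>y\<close> (interior, two axes, origin) match the four balance equations.\<close>

lemma invariant_measure_has_sum:
  assumes "invariant_measure p h v m"
  shows "((\<lambda>z. case_prod m z * qp_kernel p h v z y) has_sum case_prod m y) UNIV"
proof -
  obtain i j where y: "y = (i, j)" by force
  let ?N = "{i - 1..i + 1} \<times> {j - 1..j + 1}"
  have sum: "(\<Sum>z\<in>?N. case_prod m z * qp_kernel p h v z y) = case_prod m y"
  proof (cases "i > 0"; cases "j > 0")
    assume "i > 0" "j > 0"
    then obtain a b where ab: "i = Suc a" "j = Suc b" by (auto simp: gr0_conv_Suc)
    have "m (Suc a) (Suc b) = (\<Sum>s\<in>{-1..1}. \<Sum>t\<in>{-1..1}.
        m (nat (int (Suc a) - s)) (nat (int (Suc b) - t)) * p s t)"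
      using assms unfolding invariant_measure_def by blast
    note eq = this[unfolded sum_steps nat_steps, symmetric]
    show ?thesis
      unfolding y ab prod.case sum.cartesian_product' neighbours_Suc
      by (rule trans[OF _ eq]) (simp add: qp_kernel_def)
  next
    assume "i > 0" "\<not> j > 0"
    then obtain a where ab: "i = Suc a" "j = 0" by (auto simp: gr0_conv_Suc)
    have "m (Suc a) 0 = (\<Sum>s\<in>{-1..1}. m (nat (int (Suc a) - s)) 1 * p s (-1)) +
        (\<Sum>s\<in>{-1..1}. m (nat (int (Suc a) - s)) 0 * h s)"
      using assms unfolding invariant_measure_def by blast
    note eq = this[unfolded sum_steps nat_steps, symmetric]
    show ?thesis
      unfolding y ab prod.case sum.cartesian_product' neighbours_Suc neighbours_0
      by (rule trans[OF _ eq]) (simp add: qp_kernel_def)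
  next
    assume "\<not> i > 0" "j > 0"
    then obtain b where ab: "i = 0" "j = Suc b" by (auto simp: gr0_conv_Suc)
    have "m 0 (Suc b) = (\<Sum>t\<in>{-1..1}. m 1 (nat (int (Suc b) - t)) * p (-1) t) +
        (\<Sum>t\<in>{-1..1}. m 0 (nat (int (Suc b) - t)) * v t)"
      using assms unfolding invariant_measure_def by blast
    note eq = this[unfolded sum_steps nat_steps, symmetric]
    show ?thesis
      unfolding y ab prod.case sum.cartesian_product' neighbours_Suc neighbours_0
      by (rule trans[OF _ eq]) (simp add: qp_kernel_def)
  next
    assume "\<not> i > 0" "\<not> j > 0"
    then have ab: "i = 0" "j = 0" by auto
    have "m 0 0 = m 1 1 * p (-1) (-1) + m 1 0 * h (-1) + m 0 1 * v (-1)
        + m 0 0 * (1 - h 1 - v 1 - p 1 1)"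
      using assms unfolding invariant_measure_def by blast
    note eq = this[symmetric]
    show ?thesis
      unfolding y ab prod.case sum.cartesian_product' neighbours_0
      by (rule trans[OF _ eq]) (simp add: qp_kernel_def)
  qed
  have "((\<lambda>z. case_prod m z * qp_kernel p h v z y) has_sum case_prod m y) ?N"
    by (subst has_sum_finite_iff) (use sum in simp_all)
  then show ?thesis
  proof (rule has_sum_cong_neutral[THEN iffD1, rotated -1])
    fix z assume "z \<in> UNIV - ?N"
    then show "case_prod m z * qp_kernel p h v z y = 0"
      using qp_kernel_nonzero_imp(3,4)[of p h v "fst z" "snd z" i j] by (cases z) (auto simp: y)
  qed auto
qed

theorem theorem1:
  fixes p :: "int \<Rightarrow> int \<Rightarrow> real" and h v :: "int \<Rightarrow> real"
    and m :: "nat \<Rightarrow> nat \<Rightarrow> real" and \<Gamma> :: "(real \<times> real) set"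
  assumes "quarter_plane_walk p h v"
    and "irreducible_chain (qp_kernel p h v)"
    and "aperiodic_chain (qp_kernel p h v)"
    and "positive_recurrent_chain (qp_kernel p h v)"
    and "invariant_measure p h v m"
    and "\<Gamma> \<subseteq> {0..} \<times> {0..}"
    and "finite \<Gamma>"
    and "induced_by m \<Gamma>"
  shows "nondegenerate \<Gamma> \<subseteq> C p"
proof -
  obtain \<alpha> where \<alpha>: "\<And>x. x \<in> \<Gamma> \<Longrightarrow> \<alpha> x \<noteq> 0"
    and "\<And>i j. ((\<lambda>(\<rho>, \<sigma>). \<alpha> (\<rho>, \<sigma>) * \<rho> ^ i * \<sigma> ^ j) has_sum m i j) \<Gamma>"
    using assms(8) unfolding induced_by_def by blast
  then have m: "m i j = (\<Sum>x\<in>\<Gamma>. \<alpha> x * fst x ^ i * snd x ^ j)" for i j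
    using assms(7) by (auto simp: has_sum_finite_iff case_prod_beta)
  interpret finitely_branching_chain "qp_kernel p h v"
    by (rule finitely_branching_chain_qp_kernel) fact
  have m_nonneg: "m i j \<ge> 0" for i j
    using assms(5) by (simp add: invariant_measure_def)
  have summable: "case_prod m summable_on UNIV"
    using invariant_measure_summable[OF assms(2,4)] invariant_measure_has_sum[OF assms(5)] m_nonneg
    by (auto simp: case_prod_beta)
  \<comment> \<open>Rows and columns are injective sequences of states, and a summable family tends
    to 0 along each such sequence.\<close>
  have lim: "(\<lambda>n. case_prod m (g n)) \<longlonglongrightarrow> 0" if "inj g" for g :: "nat \<Rightarrow> nat \<times> nat"
  proof -
    have "case_prod m summable_on range g"
      using summable summable_on_subset_banach by blast
    then have "(case_prod m \<circ> g) summable_on UNIV"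
      using summable_on_reindex that by blast
    then have "summable (case_prod m \<circ> g)"
      by (simp add: summable_on_UNIV_nonneg_real_iff m_nonneg case_prod_beta)
    then show ?thesis using summable_LIMSEQ_zero by (simp add: o_def)
  qed
  show ?thesis
  proof
    fix x assume "x \<in> nondegenerate \<Gamma>"
    then have x: "x \<in> \<Gamma>" by (auto simp: nondegenerate_def)
    then have pos: "fst x \<ge> 0" "snd x \<ge> 0" using assms(6) by auto
    have less_1: "r < 1" if "(\<lambda>n. \<alpha> x * r ^ n) \<longlonglongrightarrow> 0" for r
    proof -
      have "(\<lambda>n. r ^ n) \<longlonglongrightarrow> 0"
        using tendsto_mult_left[OF that, of "1 / \<alpha> x"] \<alpha>[OF x] by simp
      then have "\<not> 1 \<le> r"
        using LIMSEQ_le_const[of "\<lambda>n. r ^ n" 0 1] one_le_power[of r] by auto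
      then show ?thesis by simp
    qed
    \<comment> \<open>Here the shift-invariant space consists of the functions vanishing at infinity
      in \<open>i\<close> for each fixed \<open>j\<close>.\<close>
    have "(\<lambda>i j. \<alpha> x * fst x ^ i * snd x ^ j) \<in> {f. \<forall>j. (\<lambda>i. f i j) \<longlonglongrightarrow> 0}"
    proof (rule sum_exponentials_component_mem[OF _ _ _ _ assms(7) _ x])
      show "(\<lambda>i j. \<Sum>x\<in>\<Gamma>. \<alpha> x * fst x ^ i * snd x ^ j) \<in> {f. \<forall>j. (\<lambda>i. f i j) \<longlonglongrightarrow> 0}"
        unfolding m[symmetric] using lim[of "\<lambda>i. (i, _)"] by (auto simp: inj_def)
    qed (auto intro: tendsto_diff[where b = 0, simplified] tendsto_mult_right_zero LIMSEQ_Suc)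
    then have "(\<lambda>i. \<alpha> x * fst x ^ i * snd x ^ 0) \<longlonglongrightarrow> 0" by blast
    then have 1: "fst x < 1" using less_1 by simp
    have "(\<lambda>i j. \<alpha> x * fst x ^ i * snd x ^ j) \<in> {f. \<forall>i. (\<lambda>j. f i j) \<longlonglongrightarrow> 0}"
    proof (rule sum_exponentials_component_mem[OF _ _ _ _ assms(7) _ x])
      show "(\<lambda>i j. \<Sum>x\<in>\<Gamma>. \<alpha> x * fst x ^ i * snd x ^ j) \<in> {f. \<forall>i. (\<lambda>j. f i j) \<longlonglongrightarrow> 0}"
        unfolding m[symmetric] using lim[of "\<lambda>j. (_, j)"] by (auto simp: inj_def)
    qed (auto intro: tendsto_diff[where b = 0, simplified] tendsto_mult_right_zero LIMSEQ_Suc)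
    then have "(\<lambda>j. \<alpha> x * fst x ^ 0 * snd x ^ j) \<longlonglongrightarrow> 0" by blast
    then have 2: "snd x < 1" using less_1 by simp
    \<comment> \<open>Applied to the zero space, the lemma says that a vanishing sum has vanishing
      terms.\<close>
    have "(\<lambda>i j. \<alpha> x * Q p (fst x) (snd x) * fst x ^ i * snd x ^ j) \<in> {\<lambda>i j. 0}"
    proof (rule sum_exponentials_component_mem[OF _ _ _ _ assms(7) _ x])
      have "(\<Sum>x\<in>\<Gamma>. \<alpha> x * Q p (fst x) (snd x) * fst x ^ i * snd x ^ j) = 0" for i j
      proof -
        \<comment> \<open>The equation at \<open>(Suc i, Suc j)\<close> leaves the exponents
          \<open>1 - s\<close> and \<open>1 - t\<close> once the powers \<open>i\<close> and
          \<open>j\<close> are split off, which are those of the polynomial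
          \<open>Q\<close>.\<close>
        have "m (Suc i) (Suc j) = (\<Sum>s\<in>{-1..1}. \<Sum>t\<in>{-1..1}.
            m (nat (int (Suc i) - s)) (nat (int (Suc j) - t)) * p s t)"
          using assms(5) unfolding invariant_measure_def by blast
        also have "\<dots> = (\<Sum>s\<in>{-1..1}. \<Sum>t\<in>{-1..1}. \<Sum>x\<in>\<Gamma>.
            \<alpha> x * (fst x ^ nat (1 - s) * snd x ^ nat (1 - t) * p s t) * fst x ^ i * snd x ^ j)"
        proof (intro sum.cong refl)
          fix s t :: int assume "s \<in> {-1..1}" "t \<in> {-1..1}"
          then have "nat (int (Suc i) - s) = nat (1 - s) + i" "nat (int (Suc j) - t) = nat (1 - t) + j"
            by auto
          then show "m (nat (int (Suc i) - s)) (nat (int (Suc j) - t)) * p s t = (\<Sum>x\<in>\<Gamma>.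
            \<alpha> x * (fst x ^ nat (1 - s) * snd x ^ nat (1 - t) * p s t) * fst x ^ i * snd x ^ j)"
            unfolding m by (simp add: power_add sum_distrib_left mult_ac)
        qed
        also have "\<dots> = (\<Sum>x\<in>\<Gamma>. \<alpha> x * (\<Sum>s\<in>{-1..1}. \<Sum>t\<in>{-1..1}.
            fst x ^ nat (1 - s) * snd x ^ nat (1 - t) * p s t) * fst x ^ i * snd x ^ j)"
          unfolding sum_distrib_left sum_distrib_right
          by (subst sum.swap[of _ \<Gamma>]) (intro sum.cong refl sum.swap)
        finally show ?thesis
          unfolding m[of "Suc i" "Suc j"] Q_def
          by (simp add: algebra_simps sum_subtractf)
      qed
      then show "(\<lambda>i j. \<Sum>x\<in>\<Gamma>. \<alpha> x * Q p (fst x) (snd x) * fst x ^ i * snd x ^ j) \<in> {\<lambda>i j. 0}"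
        by simp
    qed auto
    then have "\<alpha> x * Q p (fst x) (snd x) * fst x ^ 0 * snd x ^ 0 = 0" by (metis singletonD)
    then have "Q p (fst x) (snd x) = 0" using \<alpha>[OF x] by simp
    with 1 2 pos show "x \<in> C p" by (auto simp: C_def case_prod_beta)
  qed
qed

end
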